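(* Let $d\ge 2$ be an integer. There exists $F \in M_b(\mathbb{R}^d;\mathbb{R}^d)$ with $\operatorname{div}F=0$ in the sense of distributions and $$\sup_{t>0}\, t\,\mathcal{H}^{1}_\infty\left(\{x\in\mathbb{R}^d : |\mathrm{I}_{d-1} F(x)|>t\}\right) =+\infty.$$
   Context: $M_b(\mathbb{R}^d;\mathbb{R}^d)$ is the space of $\mathbb{R}^d$-valued Borel measures on $\mathbb{R}^d$ of bounded total variation. $\operatorname{div}F=0$ means $\int_{\mathbb{R}^d}\nabla\varphi\cdot dF=0$ for all $\varphi\in C_c^\infty(\mathbb{R}^d)$. $\mathrm{I}_{d-1}$ denotes the Riesz potential of order $d-1$, applied componentwise: $\mathrm{I}_{d-1} F(x)=c_d\int_{\mathbb{R}^d}\frac{dF(y)}{|x-y|}$ with a normalizing constant $c_d>0$ (whose value is immaterial), at points $x$ where the integral converges absolutely (which is Lebesgue a.e. $x$), and $\mathrm{I}_{d-1}F$ is set to $0$ elsewhere. $\mathcal{H}^1_\infty$ is the one-dimensional Hausdorff content: $\mathcal{H}^1_\infty(E)=\inf\{\sum_i r_i : E\subset\bigcup_i B(x_i,r_i)\}$, the infimum over countable covers by balls (up to an immaterial normalizing constant). *)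

theory Defs
  imports "HOL-Analysis.Analysis"
begin

text \<open>A vector-valued Borel measure is represented by its set function; the values on
  non-Borel sets are irrelevant. The series in \<open>vector_measure\<close> converges
  unconditionally, since every rearrangement of the sets has the same union.\<close>

definition vector_measure ::
    "('a::topological_space set \<Rightarrow> 'b::real_normed_vector) \<Rightarrow> bool" where
  "vector_measure F \<longleftrightarrow>
     F {} = 0 \<and>
     (\<forall>A :: nat \<Rightarrow> 'a set. range A \<subseteq> sets borel \<longrightarrow> disjoint_family A \<longrightarrow>
        (\<lambda>i. F (A i)) sums F (\<Union>i. A i))"

definition variation ::
    "('a::topological_space set \<Rightarrow> 'b::real_normed_vector) \<Rightarrow> 'a set \<Rightarrow> ennreal" where
  "variation F A =
     (SUP P \<in> {P. finite P \<and> partition_on A P \<and> P \<subseteq> sets borel}.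
        \<Sum>B\<in>P. ennreal (norm (F B)))"

text \<open>\<open>variation F\<close> is countably additive on the Borel sets whenever \<open>F\<close> is a vector
  measure, so \<open>measure_of\<close> does not degenerate to the null measure here; the same holds for
  \<open>upper_variation\<close> below.\<close>

definition variation_measure ::
    "('a::topological_space set \<Rightarrow> 'b::real_normed_vector) \<Rightarrow> 'a measure" where
  "variation_measure F = measure_of UNIV (sets borel) (variation F)"

definition bounded_vector_measures ::
    "('a::topological_space set \<Rightarrow> 'b::real_normed_vector) set" where
  "bounded_vector_measures = {F. vector_measure F \<and> variation F UNIV < \<infinity>}"

text \<open>The upper variation is the positive part of the Jordan decomposition of a finite
  signed measure \<open>\<mu>\<close>. Since \<open>ennreal\<close> sends negative reals to \<open>0\<close>, no
  truncation is needed.\<close>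

definition upper_variation :: "('a::topological_space set \<Rightarrow> real) \<Rightarrow> 'a measure" where
  "upper_variation \<mu> =
     measure_of UNIV (sets borel) (\<lambda>A. SUP B \<in> {B \<in> sets borel. B \<subseteq> A}. ennreal (\<mu> B))"

definition lower_variation :: "('a::topological_space set \<Rightarrow> real) \<Rightarrow> 'a measure" where
  "lower_variation \<mu> = upper_variation (\<lambda>A. - \<mu> A)"

definition signed_integral ::
    "('a::topological_space set \<Rightarrow> real) \<Rightarrow> ('a \<Rightarrow> real) \<Rightarrow> real" where
  "signed_integral \<mu> f =
     integral\<^sup>L (upper_variation \<mu>) f - integral\<^sup>L (lower_variation \<mu>) f"

text \<open>\<open>\<integral> f dF\<close> for scalar \<open>f\<close>, and \<open>\<integral> X \<cdot> dF\<close> for a vector field \<open>X\<close>.\<close>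

definition vector_integral ::
    "('a::topological_space set \<Rightarrow> real^'n) \<Rightarrow> ('a \<Rightarrow> real) \<Rightarrow> real^'n" where
  "vector_integral F f = (\<chi> i. signed_integral (\<lambda>A. F A $ i) f)"

definition dot_integral ::
    "('a::topological_space set \<Rightarrow> real^'n) \<Rightarrow> ('a \<Rightarrow> real^'n) \<Rightarrow> real" where
  "dot_integral F X = (\<Sum>i\<in>UNIV. signed_integral (\<lambda>A. F A $ i) (\<lambda>y. X y $ i))"

primrec times_cont_diff :: "nat \<Rightarrow> ('a::real_normed_vector \<Rightarrow> real) \<Rightarrow> bool" where
  "times_cont_diff 0 f \<longleftrightarrow> continuous_on UNIV f"
| "times_cont_diff (Suc k) f \<longleftrightarrow>
     (\<forall>x. f differentiable (at x)) \<and>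
     (\<forall>v. times_cont_diff k (\<lambda>x. frechet_derivative f (at x) v))"

definition test_function :: "('a::real_normed_vector \<Rightarrow> real) \<Rightarrow> bool" where
  "test_function \<phi> \<longleftrightarrow> (\<forall>k. times_cont_diff k \<phi>) \<and> compact (closure {x. \<phi> x \<noteq> 0})"

definition grad :: "(real^'n \<Rightarrow> real) \<Rightarrow> real^'n \<Rightarrow> real^'n" where
  "grad \<phi> x = (\<chi> i. frechet_derivative \<phi> (at x) (axis i 1))"

definition divergence_free :: "((real^'n) set \<Rightarrow> real^'n) \<Rightarrow> bool" where
  "divergence_free F \<longleftrightarrow> (\<forall>\<phi>. test_function \<phi> \<longrightarrow> dot_integral F (grad \<phi>) = 0)"

text \<open>The Riesz potential of order \<open>d - 1\<close> has kernel \<open>c / |x - y|\<close>, where \<open>c\<close> is the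
  normalizing constant. Absolute convergence is tested with the \<open>ennreal\<close> inverse, for
  which \<open>inverse 0 = \<infinity>\<close>, so that the integral diverges if \<open>F\<close> has an atom at \<open>x\<close>.
  Where it converges, \<open>{x}\<close> is a null set and the value \<open>1 / 0 = 0\<close> of the real
  kernel at \<open>y = x\<close> plays no role.\<close>

definition riesz_potential ::
    "real \<Rightarrow> ((real^'n) set \<Rightarrow> real^'n) \<Rightarrow> real^'n \<Rightarrow> real^'n" where
  "riesz_potential c F x =
     (if (\<integral>\<^sup>+ y. inverse (ennreal (dist x y)) \<partial>variation_measure F) < \<infinity>
      then c *\<^sub>R vector_integral F (\<lambda>y. 1 / dist x y)
      else 0)"

text \<open>One-dimensional Hausdorff content. Balls of radius \<open>0\<close> are empty, so sequences
  also account for finite covers.\<close>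

definition hausdorff_content1 :: "'a::metric_space set \<Rightarrow> ennreal" where
  "hausdorff_content1 E =
     (INF (x, r) \<in> {(x :: nat \<Rightarrow> 'a, r :: nat \<Rightarrow> real).
                       (\<forall>i. 0 \<le> r i) \<and> E \<subseteq> (\<Union>i. ball (x i) (r i))}.
        \<Sum>i. ennreal (r i))"

end

theory Submission
  imports Defs
begin

text \<open>The witness is the tangent measure of a closed curve: the boundary of a unit square that is
  spanned by two coordinate directions, run through once. It is divergence-free because the
  integral of a gradient along a closed curve vanishes, and its total variation is at most the
  length of the curve.

  The kernel \<open>1 / |x - y|\<close> has the same homogeneity as arc length, so the potential of a segment
  is infinite on the segment, with logarithmic growth. Close to one side of the square the
  opposite side contributes a bounded amount to the tangential component of the potential, and
  the two perpendicular sides contribute nothing, so that no cancellation occurs. Hence every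
  superlevel set \<open>{|I F| > t}\<close> contains a copy, shifted off the curve, of a fixed part of the
  side. The content of a segment is at least half its length (\<open>content_ge_segment\<close>), so the
  content of the superlevel sets does not tend to \<open>0\<close> as \<open>t\<close> grows, and the factor \<open>t\<close> makes the
  supremum infinite. The shift is needed because on the curve itself the integral diverges and
  the potential has the value \<open>0\<close> there.\<close>

section \<open>Integration against differences of singular measures\<close>

text \<open>If \<open>M\<close> lives on \<open>S\<close> and \<open>N\<close> off \<open>S\<close>, then \<open>S\<close> is a Hahn set of \<open>M - N\<close>: the supremum that
  defines the upper variation of \<open>A\<close> is attained at \<open>A \<inter> S\<close>.\<close>

lemma upper_variation_singular:
  fixes M N :: "'a::topological_space measure"
  assumes "finite_measure M" "finite_measure N"
    and sets: "sets M = sets borel" "sets N = sets borel"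
    and S: "S \<in> sets borel" "emeasure N S = 0" "emeasure M (- S) = 0"
  shows "upper_variation (\<lambda>A. measure M A - measure N A) = M"
proof -
  interpret M: finite_measure M by fact
  interpret N: finite_measure N by fact
  have space: "space M = UNIV"
    using sets_eq_imp_space_eq[OF sets(1)] by simp
  have "(SUP B \<in> {B \<in> sets borel. B \<subseteq> A}. ennreal (measure M B - measure N B)) = emeasure M A"
    if A: "A \<in> sets borel" for A
  proof (intro antisym SUP_least)
    fix B assume "B \<in> {B \<in> sets borel. B \<subseteq> A}"
    then have "measure M B - measure N B \<le> measure M A"
      using A sets M.finite_measure_mono[of B A] measure_nonneg[of N B] by auto (smt (verit) measure_nonneg)
    then show "ennreal (measure M B - measure N B) \<le> emeasure M A"
      by (simp add: M.emeasure_eq_measure ennreal_leI)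
  next
    have "emeasure N (A \<inter> S) = 0"
      using emeasure_mono[of "A \<inter> S" S N] S sets by simp
    moreover have "emeasure M (A \<inter> S) = emeasure M A"
    proof (rule emeasure_eq_AE)
      have "- S \<in> null_sets M" using S sets by auto
      then have "AE x in M. x \<in> S" by (auto dest: AE_not_in)
      then show "AE x in M. (x \<in> A \<inter> S) = (x \<in> A)" by auto
    qed (use A S sets in auto)
    ultimately have "emeasure M A = ennreal (measure M (A \<inter> S) - measure N (A \<inter> S))"
      by (simp add: M.emeasure_eq_measure N.emeasure_eq_measure)
    also have "\<dots> \<le> (SUP B \<in> {B \<in> sets borel. B \<subseteq> A}. ennreal (measure M B - measure N B))"
      using A S by (intro SUP_upper) auto
    finally show "emeasure M A
        \<le> (SUP B \<in> {B \<in> sets borel. B \<subseteq> A}. ennreal (measure M B - measure N B))" .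
  qed
  then have "upper_variation (\<lambda>A. measure M A - measure N A)
      = measure_of UNIV (sets borel) (emeasure M)"
    unfolding upper_variation_def
    by (intro measure_of_eq) (auto simp: sets.sigma_sets_eq[of borel, simplified])
  also have "\<dots> = M"
    using measure_of_of_measure[of M] by (simp add: sets space)
  finally show ?thesis .
qed

lemma signed_integral_singular:
  fixes M N :: "'a::topological_space measure"
  assumes "finite_measure M" "finite_measure N"
    and "sets M = sets borel" "sets N = sets borel"
    and "S \<in> sets borel" "emeasure N S = 0" "emeasure M (- S) = 0"
  shows "signed_integral (\<lambda>A. measure M A - measure N A) f = integral\<^sup>L M f - integral\<^sup>L N f"
proof -
  have "lower_variation (\<lambda>A. measure M A - measure N A) = N"
    using upper_variation_singular[of N M "- S"] assms by (simp add: lower_variation_def)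
  with upper_variation_singular[OF assms] show ?thesis
    by (simp add: signed_integral_def)
qed

lemma signed_integral_zero: "signed_integral (\<lambda>A :: 'a::topological_space set. 0) f = 0"
  by (simp add: signed_integral_def lower_variation_def)

section \<open>Dominated vector measures\<close>

lemma variation_le_sum_emeasure:
  fixes F :: "'a::topological_space set \<Rightarrow> 'b::real_normed_vector"
  assumes sets: "\<And>k. k \<in> K \<Longrightarrow> sets (M k) = sets borel"
    and le: "\<And>B. B \<in> sets borel \<Longrightarrow> ennreal (norm (F B)) \<le> (\<Sum>k\<in>K. emeasure (M k) B)"
  shows "variation F A \<le> (\<Sum>k\<in>K. emeasure (M k) A)"
  unfolding variation_def
proof (rule SUP_least, clarify)
  fix P assume P: "finite P" "partition_on A P" "P \<subseteq> sets borel"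
  have A: "(\<Union>B\<in>P. B) = A"
    using P by (auto simp: partition_on_def)
  have "(\<Sum>B\<in>P. ennreal (norm (F B))) \<le> (\<Sum>B\<in>P. \<Sum>k\<in>K. emeasure (M k) B)"
    using P le by (intro sum_mono) auto
  also have "\<dots> = (\<Sum>k\<in>K. \<Sum>B\<in>P. emeasure (M k) B)"
    by (rule sum.swap)
  also have "\<dots> = (\<Sum>k\<in>K. emeasure (M k) A)"
  proof (rule sum.cong[OF refl])
    fix k assume "k \<in> K"
    then have "(\<Sum>B\<in>P. emeasure (M k) B) = emeasure (M k) (\<Union>B\<in>P. B)"
      using P sets by (intro sum_emeasure)
        (auto simp: partition_on_def disjoint_def disjoint_family_on_def)
    then show "(\<Sum>B\<in>P. emeasure (M k) B) = emeasure (M k) A" by (simp only: A)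
  qed
  finally show "(\<Sum>B\<in>P. ennreal (norm (F B))) \<le> (\<Sum>k\<in>K. emeasure (M k) A)" .
qed

text \<open>By the convention of \<open>measure_of\<close>, the value is either \<open>variation F A\<close> or the default \<open>0\<close>. Upper
  bounds on \<open>variation F\<close> therefore carry over to \<open>variation_measure F\<close> directly.\<close>

lemma emeasure_variation_measure_le: "emeasure (variation_measure F) A \<le> variation F A"
  by (simp add: variation_measure_def emeasure_measure_of_conv)

lemma sets_variation_measure: "sets (variation_measure F) = sets borel"
  using sets.sigma_sets_eq[of borel] by (simp add: variation_measure_def)

text \<open>This is the convergence condition in \<open>riesz_potential\<close> at a point off the support of \<open>F\<close>: the
  ball of radius \<open>h\<close> carries no mass, and the kernel is at most \<open>1 / h\<close> outside it.\<close>

lemma riesz_kernel_integral_finite: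
  fixes F :: "'a::metric_space set \<Rightarrow> 'b::real_normed_vector"
  assumes fin: "variation F UNIV < \<infinity>" and h: "h > 0" and null: "variation F (ball x h) = 0"
  shows "(\<integral>\<^sup>+ y. inverse (ennreal (dist x y)) \<partial>variation_measure F) < \<infinity>"
proof -
  let ?V = "variation_measure F"
  have "ball x h \<in> null_sets ?V"
    using emeasure_variation_measure_le[of F "ball x h"] null
    by (auto simp: sets_variation_measure)
  then have "AE y in ?V. y \<notin> ball x h" by (rule AE_not_in)
  then have "(\<integral>\<^sup>+ y. inverse (ennreal (dist x y)) \<partial>?V) \<le> (\<integral>\<^sup>+ y. inverse (ennreal h) \<partial>?V)"
  proof (intro nn_integral_mono_AE, elim eventually_mono)
    fix y assume "y \<notin> ball x h"
    then have "h \<le> dist x y" "0 < dist x y" using h by auto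
    then show "inverse (ennreal (dist x y)) \<le> inverse (ennreal h)"
      using h by (simp add: inverse_ennreal ennreal_leI le_imp_inverse_le)
  qed
  also have "\<dots> = inverse (ennreal h) * emeasure ?V UNIV"
    using sets_eq_imp_space_eq[OF sets_variation_measure[of F]] by simp
  also have "\<dots> < \<infinity>"
    using le_less_trans[OF emeasure_variation_measure_le fin] h
    by (simp add: ennreal_mult_less_top inverse_ennreal)
  finally show ?thesis .
qed

section \<open>Arc length on a segment\<close>

definition segment_measure :: "'a::euclidean_space \<Rightarrow> 'a \<Rightarrow> 'a measure" where
  "segment_measure p v = distr (density lborel (indicator {0..1::real})) borel (\<lambda>s. p + s *\<^sub>R v)"

lemma sets_segment_measure [simp]: "sets (segment_measure p v) = sets borel"
  by (simp add: segment_measure_def)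

lemma emeasure_segment_measure:
  assumes "A \<in> sets borel"
  shows "emeasure (segment_measure p v) A = emeasure lborel {s \<in> {0..1}. p + s *\<^sub>R v \<in> A}"
proof -
  have m: "(\<lambda>s::real. p + s *\<^sub>R v) \<in> borel_measurable borel" by measurable
  have [measurable]: "(\<lambda>s::real. p + s *\<^sub>R v) -` A \<in> sets borel"
    using measurable_sets[OF m assms] by simp
  have "emeasure (segment_measure p v) A
      = (\<integral>\<^sup>+ s. indicator {0..1} s * indicator ((\<lambda>s. p + s *\<^sub>R v) -` A) s \<partial>lborel)"
    using assms by (simp add: segment_measure_def emeasure_distr emeasure_density)
  also have "\<dots> = (\<integral>\<^sup>+ s. indicator ({0..1} \<inter> (\<lambda>s. p + s *\<^sub>R v) -` A) s \<partial>lborel)"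
    by (simp add: indicator_inter_arith)
  also have "\<dots> = emeasure lborel ({0..1} \<inter> (\<lambda>s. p + s *\<^sub>R v) -` A)"
    by (intro nn_integral_indicator) auto
  finally show ?thesis
    by (simp add: vimage_def Int_def)
qed

lemma emeasure_segment_measure_eq_0:
  assumes "A \<in> sets borel" "\<And>s. 0 \<le> s \<Longrightarrow> s \<le> 1 \<Longrightarrow> p + s *\<^sub>R v \<notin> A"
  shows "emeasure (segment_measure p v) A = 0"
proof -
  have "{s \<in> {0..1}. p + s *\<^sub>R v \<in> A} = {}" using assms(2) by auto
  then show ?thesis using assms(1) by (simp only: emeasure_segment_measure emeasure_empty)
qed

lemma finite_measure_segment_measure: "finite_measure (segment_measure p v)"
proof
  have "emeasure (segment_measure p v) (space (segment_measure p v)) = emeasure lborel {0..1::real}"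
    by (simp add: emeasure_segment_measure sets_eq_imp_space_eq[OF sets_segment_measure]
        flip: atLeastAtMost_iff)
  then show "emeasure (segment_measure p v) (space (segment_measure p v)) \<noteq> \<infinity>"
    by simp
qed

lemma integral_segment_measure:
  fixes f :: "'a::euclidean_space \<Rightarrow> real"
  assumes [measurable]: "f \<in> borel_measurable borel"
  shows "integral\<^sup>L (segment_measure p v) f
       = (\<integral>s. indicator {0..1} s *\<^sub>R f (p + s *\<^sub>R v) \<partial>lborel)"
proof -
  have "integral\<^sup>L (segment_measure p v) f
      = (\<integral>s. f (p + s *\<^sub>R v) \<partial>density lborel (indicator {0..1::real}))"
    unfolding segment_measure_def by (rule integral_distr) measurable
  also have "density lborel (indicator {0..1::real})
      = density lborel (\<lambda>s. ennreal (indicator {0..1::real} s))"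
    by (intro arg_cong[where f = "density lborel"] ext) (simp add: ennreal_indicator)
  also have "(\<integral>s. f (p + s *\<^sub>R v) \<partial>density lborel (\<lambda>s. ennreal (indicator {0..1::real} s)))
      = (\<integral>s. indicator {0..1} s *\<^sub>R f (p + s *\<^sub>R v) \<partial>lborel)"
    by (rule integral_density) auto
  finally show ?thesis .
qed

lemma integral_segment_measure_derivative:
  fixes \<phi> :: "'a::euclidean_space \<Rightarrow> real"
  assumes diff: "\<And>x. \<phi> differentiable (at x)"
    and cont: "continuous_on UNIV (\<lambda>x. frechet_derivative \<phi> (at x) v)"
  shows "integral\<^sup>L (segment_measure p v) (\<lambda>x. frechet_derivative \<phi> (at x) v) = \<phi> (p + v) - \<phi> p"
proof -
  let ?D = "\<lambda>x. frechet_derivative \<phi> (at x) v"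
  have [measurable]: "?D \<in> borel_measurable borel"
    by (rule borel_measurable_continuous_onI[OF cont])
  have "(\<integral>s. indicator {0..1} s *\<^sub>R ?D (p + s *\<^sub>R v) \<partial>lborel)
      = \<phi> (p + 1 *\<^sub>R v) - \<phi> (p + 0 *\<^sub>R v)"
  proof (rule integral_FTC_atLeastAtMost)
    fix s :: real
    let ?d = "frechet_derivative \<phi> (at (p + s *\<^sub>R v))"
    have d: "(\<phi> has_derivative ?d) (at (p + s *\<^sub>R v))"
      using diff frechet_derivative_works by blast
    have "((\<lambda>s. p + s *\<^sub>R v) has_derivative (\<lambda>h. h *\<^sub>R v)) (at s within {0..1})"
      by (auto intro!: derivative_eq_intros)
    from has_derivative_compose[OF this d]
    have "((\<lambda>s. \<phi> (p + s *\<^sub>R v)) has_derivative (\<lambda>h. ?d (h *\<^sub>R v))) (at s within {0..1})" .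
    then show "((\<lambda>s. \<phi> (p + s *\<^sub>R v)) has_vector_derivative ?d v) (at s within {0..1})"
      using linear_scale[OF has_derivative_linear[OF d]] by (simp add: has_vector_derivative_def)
  next
    show "continuous_on {0..1} (\<lambda>s. ?D (p + s *\<^sub>R v))"
      by (rule continuous_on_compose2[OF cont]) (auto intro!: continuous_intros)
  qed simp
  then show ?thesis by (simp add: integral_segment_measure)
qed

text \<open>A coordinate that is constant on each of two parallel segments, with different values,
  separates them.\<close>

lemma signed_integral_parallel_segments:
  fixes p q v :: "real^'n"
  assumes "v $ k = 0" "p $ k \<noteq> q $ k"
  shows "signed_integral (\<lambda>A. measure (segment_measure p v) A - measure (segment_measure q v) A) f
       = integral\<^sup>L (segment_measure p v) f - integral\<^sup>L (segment_measure q v) f"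
proof (rule signed_integral_singular)
  let ?S = "{y :: real^'n. y $ k = p $ k}"
  have "closed ?S" by (intro closed_Collect_eq continuous_intros)
  then show S: "?S \<in> sets borel" by (rule borel_closed)
  show "emeasure (segment_measure q v) ?S = 0"
    using S assms by (intro emeasure_segment_measure_eq_0) auto
  show "emeasure (segment_measure p v) (- ?S) = 0"
    using S assms by (intro emeasure_segment_measure_eq_0) auto
qed (simp_all add: finite_measure_segment_measure)

section \<open>The kernel on a segment\<close>

lemma integrable_inverse_dist_segment:
  fixes x p v :: "'a::euclidean_space"
  assumes "\<And>s. 0 \<le> s \<Longrightarrow> s \<le> 1 \<Longrightarrow> x \<noteq> p + s *\<^sub>R v"
  shows "integrable lborel (\<lambda>s. indicator {0..1} s *\<^sub>R (1 / dist x (p + s *\<^sub>R v)))"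
proof -
  have "set_integrable lborel {0..1} (\<lambda>s. 1 / dist x (p + s *\<^sub>R v))"
    using assms by (intro borel_integrable_atLeastAtMost' continuous_intros) auto
  then show ?thesis by (simp add: set_integrable_def)
qed

lemma integral_inverse_dist_segment_le:
  fixes x p v :: "'a::euclidean_space"
  assumes r: "r > 0" and far: "\<And>s. 0 \<le> s \<Longrightarrow> s \<le> 1 \<Longrightarrow> r \<le> dist x (p + s *\<^sub>R v)"
  shows "(\<integral>y. 1 / dist x y \<partial>segment_measure p v) \<le> 1 / r"
proof -
  have "(\<integral>s. indicator {0..1} s *\<^sub>R (1 / dist x (p + s *\<^sub>R v)) \<partial>lborel)
      \<le> (\<integral>s. indicator {0..1::real} s *\<^sub>R (1 / r) \<partial>lborel)"
  proof (rule integral_mono)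
    show "integrable lborel (\<lambda>s. indicator {0..1} s *\<^sub>R (1 / dist x (p + s *\<^sub>R v)))"
      using far r by (intro integrable_inverse_dist_segment) force
    show "indicator {0..1} s *\<^sub>R (1 / dist x (p + s *\<^sub>R v)) \<le> indicator {0..1} s *\<^sub>R (1 / r)"
      for s
      using far r by (auto simp: indicator_def intro!: divide_left_mono mult_pos_pos
          less_le_trans[OF r far])
  qed (auto intro!: integrable_real_indicator integrable_mult_left)
  also have "\<dots> = 1 / r" by simp
  finally show ?thesis by (simp add: integral_segment_measure)
qed

text \<open>The kernel is compared with \<open>1 / (s - a + norm w)\<close> on the stretch of length \<open>1 / 2\<close> that starts
  at the foot \<open>p + a v\<close> of the perpendicular from the point. That stretch stays inside the segment
  because \<open>a \<le> 1 / 2\<close>, and so the bound does not depend on \<open>a\<close>.\<close>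

lemma integral_inverse_dist_segment_ge:
  fixes p v w :: "'a::euclidean_space"
  assumes v: "norm v = 1" and w: "w \<noteq> 0" "w \<bullet> v = 0" and a: "0 \<le> a" "a \<le> 1 / 2"
  shows "ln (1 + 1 / (2 * norm w)) \<le> (\<integral>y. 1 / dist (p + a *\<^sub>R v + w) y \<partial>segment_measure p v)"
proof -
  let ?x = "p + a *\<^sub>R v + w" and ?h = "norm w"
  have h: "?h > 0" using w by simp
  have off: "?x \<noteq> p + s *\<^sub>R v" for s
  proof
    assume "?x = p + s *\<^sub>R v"
    then have "w = (s - a) *\<^sub>R v" by (simp add: algebra_simps)
    then have "w \<bullet> w = (s - a) * (w \<bullet> v)" by (metis inner_scaleR_right)
    then show False using w by simp
  qed
  have le: "dist ?x (p + s *\<^sub>R v) \<le> s - a + ?h" if "a \<le> s" for s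
  proof -
    have "?x - (p + s *\<^sub>R v) = (a - s) *\<^sub>R v + w" by (simp add: algebra_simps)
    then have "dist ?x (p + s *\<^sub>R v) \<le> norm ((a - s) *\<^sub>R v) + ?h"
      unfolding dist_norm by (metis norm_triangle_ineq)
    then show ?thesis using v that by simp
  qed
  have cont: "continuous_on {a..a + 1 / 2} (\<lambda>s. 1 / (s - a + ?h))"
    using h by (intro continuous_intros) (auto simp: add_nonneg_eq_0_iff)
  have "(\<integral>s. indicator {a..a + 1 / 2} s *\<^sub>R (1 / (s - a + ?h)) \<partial>lborel)
      = ln (a + 1 / 2 - a + ?h) - ln (a - a + ?h)"
  proof (rule integral_FTC_atLeastAtMost[OF _ _ cont])
    fix s assume "a \<le> s" "s \<le> a + 1 / 2"
    then show "((\<lambda>s. ln (s - a + ?h)) has_vector_derivative 1 / (s - a + ?h))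
        (at s within {a..a + 1 / 2})"
      using h unfolding has_real_derivative_iff_has_vector_derivative[symmetric]
      by (auto intro!: derivative_eq_intros add_nonneg_pos)
  qed simp
  also have "\<dots> = ln (1 + 1 / (2 * ?h))"
  proof -
    have "1 + 1 / (2 * ?h) = (1 / 2 + ?h) / ?h" using h by (simp add: field_simps)
    moreover have "1 / 2 + ?h \<noteq> 0" using h by linarith
    ultimately show ?thesis using w by (simp add: ln_div)
  qed
  finally have "ln (1 + 1 / (2 * ?h))
      = (\<integral>s. indicator {a..a + 1 / 2} s *\<^sub>R (1 / (s - a + ?h)) \<partial>lborel)" by simp
  also have "\<dots> \<le> (\<integral>s. indicator {0..1} s *\<^sub>R (1 / dist ?x (p + s *\<^sub>R v)) \<partial>lborel)"
  proof (rule integral_mono)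
    show "integrable lborel (\<lambda>s. indicator {a..a + 1 / 2} s *\<^sub>R (1 / (s - a + ?h)))"
      using borel_integrable_atLeastAtMost'[OF cont] by (simp add: set_integrable_def)
    show "integrable lborel (\<lambda>s. indicator {0..1} s *\<^sub>R (1 / dist ?x (p + s *\<^sub>R v)))"
      by (rule integrable_inverse_dist_segment) (rule off)
    fix s :: real
    show "indicator {a..a + 1 / 2} s *\<^sub>R (1 / (s - a + ?h))
        \<le> indicator {0..1} s *\<^sub>R (1 / dist ?x (p + s *\<^sub>R v))"
    proof (cases "s \<in> {a..a + 1 / 2}")
      case True
      have pos: "dist ?x (p + s *\<^sub>R v) > 0" using off[of s] by (metis zero_less_dist_iff)
      have "1 / (s - a + ?h) \<le> 1 / dist ?x (p + s *\<^sub>R v)"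
        using le[of s] True pos by (intro frac_le) auto
      then show ?thesis using True a by simp
    qed (auto simp: indicator_def)
  qed
  finally show ?thesis by (simp add: integral_segment_measure)
qed

section \<open>Hausdorff content of a segment\<close>

text \<open>Orthogonal projection onto the line of the segment does not increase distances, so a cover
  by balls of radius \<open>r i\<close> becomes a cover of an interval by intervals of length \<open>2 * r i\<close>.\<close>

lemma content_ge_segment:
  fixes p v :: "'a::real_inner"
  assumes v: "norm v = 1" and ab: "a \<le> b"
    and E: "\<And>s. a \<le> s \<Longrightarrow> s \<le> b \<Longrightarrow> p + s *\<^sub>R v \<in> E"
  shows "ennreal ((b - a) / 2) \<le> hausdorff_content1 E"
  unfolding hausdorff_content1_def
proof (rule INF_greatest, clarify)
  fix x :: "nat \<Rightarrow> 'a" and r :: "nat \<Rightarrow> real"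
  assume r: "\<forall>i. 0 \<le> r i" and cover: "E \<subseteq> (\<Union>i. ball (x i) (r i))"
  have "{a..b} \<subseteq> (\<Union>i. ball ((x i - p) \<bullet> v) (r i))"
  proof
    fix s assume "s \<in> {a..b}"
    then obtain i where i: "dist (x i) (p + s *\<^sub>R v) < r i"
      using E cover by fastforce
    have "(x i - p) \<bullet> v - s = (x i - (p + s *\<^sub>R v)) \<bullet> v"
      using v by (simp add: inner_diff_left inner_add_left flip: power2_norm_eq_inner)
    also have "\<bar>\<dots>\<bar> \<le> norm (x i - (p + s *\<^sub>R v)) * norm v"
      by (rule Cauchy_Schwarz_ineq2)
    finally show "s \<in> (\<Union>i. ball ((x i - p) \<bullet> v) (r i))"
      using i v by (auto simp: dist_norm intro!: exI[of _ i])
  qed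
  then have "emeasure lborel {a..b} \<le> emeasure lborel (\<Union>i. ball ((x i - p) \<bullet> v) (r i))"
    by (intro emeasure_mono) auto
  also have "\<dots> \<le> (\<Sum>i. emeasure lborel (ball ((x i - p) \<bullet> v) (r i)))"
    by (intro emeasure_subadditive_countably) auto
  also have "\<dots> = (\<Sum>i. 2 * ennreal (r i))"
    using r by (intro suminf_cong)
      (simp add: ball_eq_greaterThanLessThan ennreal_mult flip: ennreal_numeral)
  also have "\<dots> = 2 * (\<Sum>i. ennreal (r i))"
    by simp
  finally have "2 * ennreal ((b - a) / 2) \<le> 2 * (\<Sum>i. ennreal (r i))"
    using ab
    by (metis emeasure_lborel_Icc ennreal_mult' ennreal_numeral nonzero_mult_div_cancel_left
        times_divide_eq_right zero_le_numeral zero_neq_numeral)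
  then show "ennreal ((b - a) / 2) \<le> (\<Sum>i. ennreal (r i))"
    by (subst (asm) ennreal_mult_le_mult_iff) auto
qed

section \<open>The boundary of a square\<close>

definition square_current :: "'n \<Rightarrow> 'n \<Rightarrow> (real^'n::finite) set \<Rightarrow> real^'n" where
  "square_current i j A =
     (measure (segment_measure 0 (axis i 1)) A
        - measure (segment_measure (axis j 1) (axis i 1)) A) *\<^sub>R axis i 1
   + (measure (segment_measure (axis i 1) (axis j 1)) A
        - measure (segment_measure 0 (axis j 1)) A) *\<^sub>R axis j 1"

lemma square_current_nth:
  assumes "i \<noteq> j"
  shows "square_current i j A $ i
       = measure (segment_measure 0 (axis i 1)) A
       - measure (segment_measure (axis j 1) (axis i 1)) A"
    and "square_current i j A $ j
       = measure (segment_measure (axis i 1) (axis j 1)) A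
       - measure (segment_measure 0 (axis j 1)) A"
    and "k \<noteq> i \<Longrightarrow> k \<noteq> j \<Longrightarrow> square_current i j A $ k = 0"
  using assms by (auto simp: square_current_def axis_def)

lemma vector_measure_square_current: "vector_measure (square_current i j)"
proof -
  have "(\<lambda>k. square_current i j (A k)) sums square_current i j (\<Union>k. A k)"
    if "range A \<subseteq> sets borel" "disjoint_family A" for A :: "nat \<Rightarrow> (real^'a) set"
    unfolding square_current_def using that
    by (intro sums_add sums_diff sums_scaleR_left
        finite_measure.finite_measure_UNION[OF finite_measure_segment_measure]) auto
  moreover have "square_current i j {} = 0" by (simp add: square_current_def)
  ultimately show ?thesis by (auto simp: vector_measure_def)
qed

text \<open>The sides as pairs of base point and direction. Both sides of a pair of opposite sides point
  the same way here; the orientation of the boundary is carried by the signs in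
  \<open>square_current\<close>.\<close>

definition square_sides :: "'n \<Rightarrow> 'n \<Rightarrow> ((real^'n::finite) \<times> (real^'n)) set" where
  "square_sides i j = {(0, axis i 1), (axis j 1, axis i 1), (axis i 1, axis j 1), (0, axis j 1)}"

lemma variation_square_current_le:
  fixes i j :: "'n::finite"
  assumes "i \<noteq> j"
  shows "variation (square_current i j) A
     \<le> (\<Sum>k\<in>square_sides i j. emeasure (segment_measure (fst k) (snd k)) A)"
proof (rule variation_le_sum_emeasure)
  fix B :: "(real^'n) set"
  let ?m = "\<lambda>p v. measure (segment_measure p v) B"
  let ?a = "axis i 1 :: real^'n" and ?b = "axis j 1 :: real^'n"
  have ne: "?a \<noteq> ?b" "?b \<noteq> ?a" using assms by (auto simp: axis_eq_axis)
  have "norm (square_current i j B)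
      \<le> norm ((?m 0 ?a - ?m ?b ?a) *\<^sub>R ?a) + norm ((?m ?a ?b - ?m 0 ?b) *\<^sub>R ?b)"
    unfolding square_current_def by (rule norm_triangle_ineq)
  also have "\<dots> = \<bar>?m 0 ?a - ?m ?b ?a\<bar> + \<bar>?m ?a ?b - ?m 0 ?b\<bar>"
    by simp
  also have "\<dots> \<le> ?m 0 ?a + ?m ?b ?a + (?m ?a ?b + ?m 0 ?b)"
    by (intro add_mono) (auto simp: abs_le_iff add_increasing add_increasing2 diff_le_eq)
  also have "\<dots> = (\<Sum>k\<in>square_sides i j. ?m (fst k) (snd k))"
    using ne by (simp add: square_sides_def axis_eq_0_iff eq_commute[of 0])
  finally have "ennreal (norm (square_current i j B))
      \<le> ennreal (\<Sum>k\<in>square_sides i j. ?m (fst k) (snd k))"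
    by (rule ennreal_leI)
  then show "ennreal (norm (square_current i j B))
      \<le> (\<Sum>k\<in>square_sides i j. emeasure (segment_measure (fst k) (snd k)) B)"
    by (simp add: finite_measure.emeasure_eq_measure[OF finite_measure_segment_measure] sum_ennreal)
qed simp

lemma variation_square_current_finite:
  assumes "i \<noteq> j"
  shows "variation (square_current i j) UNIV < \<infinity>"
proof -
  have "emeasure (segment_measure p v) UNIV < \<infinity>" for p v :: "real^'a"
    by (simp add: finite_measure.emeasure_eq_measure[OF finite_measure_segment_measure])
  then show ?thesis
    by (intro le_less_trans[OF variation_square_current_le[OF assms]])
      (simp add: square_sides_def)
qed

lemma signed_integral_square_current:
  fixes i j :: "'n::finite"
  assumes "i \<noteq> j"
  shows "signed_integral (\<lambda>A. square_current i j A $ i) f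
       = integral\<^sup>L (segment_measure 0 (axis i 1)) f
       - integral\<^sup>L (segment_measure (axis j 1) (axis i 1)) f"
    and "signed_integral (\<lambda>A. square_current i j A $ j) f
       = integral\<^sup>L (segment_measure (axis i 1) (axis j 1)) f
       - integral\<^sup>L (segment_measure 0 (axis j 1)) f"
    and "k \<noteq> i \<Longrightarrow> k \<noteq> j \<Longrightarrow> signed_integral (\<lambda>A. square_current i j A $ k) f = 0"
proof -
  show "signed_integral (\<lambda>A. square_current i j A $ i) f
       = integral\<^sup>L (segment_measure 0 (axis i 1)) f
       - integral\<^sup>L (segment_measure (axis j 1) (axis i 1)) f"
    unfolding square_current_nth(1)[OF assms]
    using assms by (intro signed_integral_parallel_segments[where k = j]) (auto simp: axis_def)
  show "signed_integral (\<lambda>A. square_current i j A $ j) f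
       = integral\<^sup>L (segment_measure (axis i 1) (axis j 1)) f
       - integral\<^sup>L (segment_measure 0 (axis j 1)) f"
    unfolding square_current_nth(2)[OF assms]
    using assms by (intro signed_integral_parallel_segments[where k = i]) (auto simp: axis_def)
  show "signed_integral (\<lambda>A. square_current i j A $ k) f = 0" if "k \<noteq> i" "k \<noteq> j"
    unfolding square_current_nth(3)[OF assms that] by (rule signed_integral_zero)
qed

lemma divergence_free_square_current:
  fixes i j :: "'n::finite"
  assumes "i \<noteq> j"
  shows "divergence_free (square_current i j)"
  unfolding divergence_free_def
proof (intro allI impI)
  fix \<phi> :: "real^'n \<Rightarrow> real" assume "test_function \<phi>"
  then have "times_cont_diff (Suc 0) \<phi>" unfolding test_function_def by blast
  then have *: "integral\<^sup>L (segment_measure p v) (\<lambda>x. frechet_derivative \<phi> (at x) v)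
      = \<phi> (p + v) - \<phi> p" for p v
    by (intro integral_segment_measure_derivative) auto
  let ?I = "\<lambda>k. signed_integral (\<lambda>A. square_current i j A $ k) (\<lambda>y. grad \<phi> y $ k)"
  have "dot_integral (square_current i j) (grad \<phi>) = (\<Sum>k\<in>{i, j}. ?I k)"
    unfolding dot_integral_def
    by (intro sum.mono_neutral_right) (auto simp: signed_integral_square_current(3)[OF assms])
  also have "\<dots> = ?I i + ?I j" using assms by simp
  also have "\<dots> = 0"
    by (simp add: signed_integral_square_current[OF assms] grad_def * add.commute)
  finally show "dot_integral (square_current i j) (grad \<phi>) = 0" .
qed

section \<open>The potential close to one side\<close>

text \<open>The points lie outside the square at distance \<open>h\<close> from it, on the side away from the
  opposite edge, so that this edge is at distance at least \<open>1\<close>.\<close>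

lemma norm_riesz_potential_square_current_ge:
  fixes i j :: "'n::finite"
  assumes ij: "i \<noteq> j" and c: "c > 0" and h: "h > 0" and a: "0 \<le> a" "a \<le> 1 / 2"
  shows "c * (ln (1 + 1 / (2 * h)) - 1)
       \<le> norm (riesz_potential c (square_current i j) (- h *\<^sub>R axis j 1 + a *\<^sub>R axis i 1))"
proof -
  let ?a = "axis i 1 :: real^'n" and ?b = "axis j 1 :: real^'n"
  let ?F = "square_current i j"
  define x where "x = - h *\<^sub>R ?b + a *\<^sub>R ?a"
  have xj: "x $ j = - h" using ij by (simp add: x_def axis_def)
  have far: "z $ j + h \<le> dist x z" for z
    using component_le_norm_cart[of "x - z" j] by (simp add: dist_norm xj)
  have "variation ?F (ball x h) \<le> (\<Sum>k\<in>square_sides i j. 0)"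
  proof (rule order_trans[OF variation_square_current_le[OF ij]], rule sum_mono)
    fix k assume k: "k \<in> square_sides i j"
    have "(fst k + s *\<^sub>R snd k) $ j \<ge> 0" if "0 \<le> s" for s
      using k that by (auto simp: square_sides_def axis_def)
    then have "fst k + s *\<^sub>R snd k \<notin> ball x h" if "0 \<le> s" for s
      using far[of "fst k + s *\<^sub>R snd k"] that by (smt (verit) mem_ball)
    then show "emeasure (segment_measure (fst k) (snd k)) (ball x h) \<le> 0"
      by (subst emeasure_segment_measure_eq_0) auto
  qed
  then have "(\<integral>\<^sup>+ y. inverse (ennreal (dist x y)) \<partial>variation_measure ?F) < \<infinity>"
    using variation_square_current_finite[OF ij] h by (intro riesz_kernel_integral_finite) auto
  then have "riesz_potential c ?F x $ i
      = c * signed_integral (\<lambda>A. ?F A $ i) (\<lambda>y. 1 / dist x y)"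
    by (simp add: riesz_potential_def vector_integral_def)
  also have "\<dots> = c * ((\<integral>y. 1 / dist x y \<partial>segment_measure 0 ?a)
      - (\<integral>y. 1 / dist x y \<partial>segment_measure ?b ?a))"
    by (simp only: signed_integral_square_current[OF ij])
  also have "\<dots> \<ge> c * (ln (1 + 1 / (2 * h)) - 1)"
  proof (intro mult_left_mono diff_mono)
    have "- h *\<^sub>R ?b \<noteq> 0" "(- h *\<^sub>R ?b) \<bullet> ?a = 0" "norm (- h *\<^sub>R ?b) = h"
      using h ij by (auto simp: inner_axis_axis axis_eq_0_iff)
    with integral_inverse_dist_segment_ge[of ?a "- h *\<^sub>R ?b" a 0] a
    show "ln (1 + 1 / (2 * h)) \<le> (\<integral>y. 1 / dist x y \<partial>segment_measure 0 ?a)"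
      by (simp add: x_def add.commute)
    have "1 \<le> dist x (?b + s *\<^sub>R ?a)" for s
      using far[of "?b + s *\<^sub>R ?a"] h ij by (simp add: axis_def)
    then show "(\<integral>y. 1 / dist x y \<partial>segment_measure ?b ?a) \<le> 1"
      using integral_inverse_dist_segment_le[of 1 x ?b ?a] by simp
  qed (use c in simp)
  finally have "c * (ln (1 + 1 / (2 * h)) - 1) \<le> riesz_potential c ?F x $ i" .
  also have "\<dots> \<le> norm (riesz_potential c ?F x)"
    using component_le_norm_cart[of "riesz_potential c ?F x" i] by simp
  finally show ?thesis by (simp only: x_def)
qed

text \<open>The bound is the same for all \<open>t\<close>: raising the level only brings the shifted half of the side
  closer to the curve.\<close>

lemma content_superlevel_square_current_ge:
  fixes i j :: "'n::finite"
  assumes ij: "i \<noteq> j" and c: "c > 0" and t: "t > 0"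
  shows "ennreal (1 / 4)
       \<le> hausdorff_content1 {x. t < norm (riesz_potential c (square_current i j) x)}"
proof -
  \<comment> \<open>With this \<open>h\<close>, the lower bound on the potential equals \<open>c * (t / c + 1)\<close>.\<close>
  define h where "h = 1 / (2 * (exp (t / c + 2) - 1))"
  have e: "exp (t / c + 2) > 1" using c t by (simp add: add_pos_pos)
  then have h: "h > 0" by (simp add: h_def)
  have "1 + 1 / (2 * h) = exp (t / c + 2)" by (simp add: h_def diff_divide_distrib)
  then have "c * (ln (1 + 1 / (2 * h)) - 1) = t + c" using c by (simp add: field_simps)
  then have "t < norm (riesz_potential c (square_current i j) (- h *\<^sub>R axis j 1 + a *\<^sub>R axis i 1))"
    if "0 \<le> a" "a \<le> 1 / 2" for a
    using norm_riesz_potential_square_current_ge[OF ij c h that] c by linarith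
  then show ?thesis
    using content_ge_segment[of "axis i 1" 0 "1 / 2" "- h *\<^sub>R axis j 1"
        "{x. t < norm (riesz_potential c (square_current i j) x)}"] by simp
qed

theorem theorem1p5:
  fixes c :: real
  assumes "CARD('n::finite) \<ge> 2" and "c > 0"
  shows "\<exists>F :: (real^'n) set \<Rightarrow> real^'n.
           F \<in> bounded_vector_measures \<and> divergence_free F \<and>
           (SUP t \<in> {t::real. t > 0}.
              ennreal t * hausdorff_content1 {x. norm (riesz_potential c F x) > t}) = \<infinity>"
proof -
  obtain i j :: 'n where ij: "i \<noteq> j"
    using assms(1) by (metis (full_types) One_nat_def UNIV_I card_le_Suc0_iff_eq finite
        not_less_eq_eq numeral_2_eq_2)
  let ?F = "square_current i j"
  let ?G = "\<lambda>t. ennreal t * hausdorff_content1 {x. norm (riesz_potential c ?F x) > t}"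
  have le: "ennreal (t / 4) \<le> (SUP t \<in> {t. t > 0}. ?G t)" if t: "t > 0" for t
  proof -
    have "ennreal (t / 4) = ennreal t * ennreal (1 / 4)"
      using t by (simp flip: ennreal_mult)
    also have "\<dots> \<le> ?G t"
      using content_superlevel_square_current_ge[OF ij assms(2) t] by (intro mult_left_mono) auto
    also have "\<dots> \<le> (SUP t \<in> {t. t > 0}. ?G t)"
      using t by (intro SUP_upper) auto
    finally show ?thesis .
  qed
  have "(SUP t \<in> {t. t > 0}. ?G t) = \<infinity>"
  proof (rule ccontr)
    assume "(SUP t \<in> {t. t > 0}. ?G t) \<noteq> \<infinity>"
    then obtain r where r: "0 \<le> r" "(SUP t \<in> {t. t > 0}. ?G t) = ennreal r"
      by (cases "SUP t \<in> {t. t > 0}. ?G t") auto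
    with le[of "4 * (r + 1)"] show False by simp
  qed
  then show ?thesis
    using vector_measure_square_current[of i j] variation_square_current_finite[OF ij]
      divergence_free_square_current[OF ij]
    by (auto simp: bounded_vector_measures_def)
qed

end
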